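(* Fix $N\ge2$ and consider prefixes for $\mathrm{Av}_N(321)$ of size at most $N-1$ (including the empty prefix), with trigger probabilities regarded as pairs (numerator, denominator). (1) If $p$ contains at least one inversion, then $\mathcal{T}_N(p)=\mathcal{T}_{N-1}(\check p)$, where $\check p$ is obtained from $p$ by removing the value $1$ and flattening, and $\mathcal{T}_{N-1}$ is computed with respect to $\mathrm{Av}_{N-1}(321)$. (2) If $p=12\cdots k$ with $0\le k\le N-1$ ($k=0$ meaning the empty prefix), then $\mathcal{T}_N(p)$ has numerator $k\binom{N-1}{k+1}+\binom{N-1}{k}$ and denominator $\frac{k+1}{N+1}\binom{2N-k}{N}$.
   Context: $\mathrm{Av}_N(321)$ is the set of permutations $\pi=\pi_1\cdots\pi_N$ of $[N]$ with no indices $a<b<c$ such that $\pi_a>\pi_b>\pi_c$. $\pi|_{[k]}$ is the permutation of $[k]$ in the same relative order as $\pi_1,\dots,\pi_k$ ($\pi|_{[0]}$ is empty). A prefix of size $k$ is any $\pi|_{[k]}$ with $\pi\in\mathrm{Av}_N(321)$; it contains an inversion if $p_a>p_b$ for some $a<b$. An entry $\pi_j$ is a left-to-right maximum if $\pi_j>\pi_l$ for all $l<j$. For a prefix $p$ of size $k\le N-1$, $\pi$ is won by triggering at $p$ if $\pi|_{[k]}=p$ and the first position $j>k$ at which $\pi_j$ is a left-to-right maximum satisfies $\pi_j=N$. The trigger probability is the pair $\mathcal{T}_N(p)=\big(\#\{\pi\in\mathrm{Av}_N(321)\text{ won by triggering at }p\},\ \#\{\pi\in\mathrm{Av}_N(321):\pi|_{[k]}=p\}\big)$.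 *)

theory Defs
  imports Complex_Main "HOL-Combinatorics.Multiset_Permutations"
begin

text \<open>Permutations of \<open>{1..N}\<close> are lists in one-line notation. List positions are counted
  from 0, so the entry \<open>\<pi>\<^sub>j\<close> of the usual 1-based notation is \<open>\<pi> ! (j - 1)\<close>.\<close>

definition avoids_321 :: "nat list \<Rightarrow> bool" where
  "avoids_321 \<pi> \<longleftrightarrow>
     \<not> (\<exists>a b c. a < b \<and> b < c \<and> c < length \<pi> \<and> \<pi> ! a > \<pi> ! b \<and> \<pi> ! b > \<pi> ! c)"

definition Av321 :: "nat \<Rightarrow> nat list set" where
  "Av321 N = {\<pi> \<in> permutations_of_set {1..N}. avoids_321 \<pi>}"

text \<open>For a list of distinct numbers, each entry is replaced by its rank, the smallest entry
  having rank 1.\<close>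

definition flatten :: "nat list \<Rightarrow> nat list" where
  "flatten xs = map (\<lambda>x. card {y \<in> set xs. y \<le> x}) xs"

definition restrict_perm :: "nat list \<Rightarrow> nat \<Rightarrow> nat list" where
  "restrict_perm \<pi> k = flatten (take k \<pi>)"

definition Av321_prefixes :: "nat \<Rightarrow> nat \<Rightarrow> nat list set" where
  "Av321_prefixes N k = {restrict_perm \<pi> k |\<pi>. \<pi> \<in> Av321 N}"

definition has_inversion :: "nat list \<Rightarrow> bool" where
  "has_inversion p \<longleftrightarrow> (\<exists>a b. a < b \<and> b < length p \<and> p ! a > p ! b)"

definition lr_max :: "nat list \<Rightarrow> nat \<Rightarrow> bool" where
  "lr_max \<pi> j \<longleftrightarrow> j < length \<pi> \<and> (\<forall>l<j. \<pi> ! j > \<pi> ! l)"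

text \<open>The positions after a prefix of size \<open>k = length p\<close> are the list indices \<open>j \<ge> k\<close>.
  If no left-to-right maximum occurs after the prefix, the permutation is not won.\<close>

definition won_by_triggering :: "nat \<Rightarrow> nat list \<Rightarrow> nat list \<Rightarrow> bool" where
  "won_by_triggering N p \<pi> \<longleftrightarrow>
     restrict_perm \<pi> (length p) = p \<and>
     (\<exists>j\<ge>length p. lr_max \<pi> j \<and> (\<forall>i. length p \<le> i \<and> i < j \<longrightarrow> \<not> lr_max \<pi> i) \<and> \<pi> ! j = N)"

definition trigger_prob :: "nat \<Rightarrow> nat list \<Rightarrow> nat \<times> nat" where
  "trigger_prob N p =
     (card {\<pi> \<in> Av321 N. won_by_triggering N p \<pi>},
      card {\<pi> \<in> Av321 N. restrict_perm \<pi> (length p) = p})"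

definition remove_one :: "nat list \<Rightarrow> nat list" where
  "remove_one p = flatten (filter (\<lambda>x. x \<noteq> 1) p)"

end

theory Submission imports Defs
begin

text \<open>Deleting the value 1 from a 321-avoiding permutation of size \<open>N + 1\<close> leaves one of size \<open>N\<close>
  all of whose entries to the left of the deleted position are increasing, and conversely 1 may be
  inserted at any such position. Part (1) is this bijection for the fixed position at which the
  prefix contains 1: behind an inversion the value 1 cannot occur. For part (2), sorting the
  permutations by the position of 1 gives Pascal-like recurrences in \<open>(N, k)\<close> for the numerator and
  the denominator, which the closed forms satisfy.\<close>

definition insert_one :: "nat \<Rightarrow> nat list \<Rightarrow> nat list" where
  "insert_one i xs = map Suc (take i xs) @ 1 # map Suc (drop i xs)"

text \<open>Phrased on the raw entries, so that it passes through flattening and insertion index by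
  index. For \<open>k\<close> beyond the length it says that the whole list is increasing.\<close>

definition increasing_upto :: "nat \<Rightarrow> nat list \<Rightarrow> bool" where
  "increasing_upto k xs \<longleftrightarrow> (\<forall>a b. a < b \<and> b < k \<and> b < length xs \<longrightarrow> xs ! a < xs ! b)"

text \<open>The second conjunct of \<open>won_by_triggering\<close> with starting index and target
  value decoupled: inserting 1 shifts sometimes both, sometimes only the value.\<close>

definition next_max_at :: "nat \<Rightarrow> nat \<Rightarrow> nat list \<Rightarrow> bool" where
  "next_max_at k v \<pi> \<longleftrightarrow>
     (\<exists>j\<ge>k. lr_max \<pi> j \<and> (\<forall>i. k \<le> i \<and> i < j \<longrightarrow> \<not> lr_max \<pi> i) \<and> \<pi> ! j = v)"

lemma won_by_triggering_iff:
  "won_by_triggering N p \<pi> \<longleftrightarrow> restrict_perm \<pi> (length p) = p \<and> next_max_at (length p) N \<pi>"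
  by (simp add: won_by_triggering_def next_max_at_def)

subsection \<open>Flattening\<close>

lemma length_flatten [simp]: "length (flatten xs) = length xs"
  by (simp add: flatten_def)

lemma length_restrict_perm [simp]: "length (restrict_perm xs k) = min k (length xs)"
  by (simp add: restrict_perm_def)

text \<open>If \<open>u < v\<close>, then \<open>v\<close> itself lies in the second down-set only;
  otherwise the second is contained in the first.\<close>

lemma rank_less_iff:
  fixes A :: "nat set"
  assumes "finite A" "v \<in> A"
  shows "card {y \<in> A. y \<le> u} < card {y \<in> A. y \<le> v} \<longleftrightarrow> u < v"
proof
  assume "u < v"
  then have "{y \<in> A. y \<le> u} \<subseteq> {y \<in> A. y \<le> v}" "v \<in> {y \<in> A. y \<le> v} - {y \<in> A. y \<le> u}"
    using assms by auto
  then show "card {y \<in> A. y \<le> u} < card {y \<in> A. y \<le> v}"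
    using assms by (intro psubset_card_mono) auto
next
  assume less: "card {y \<in> A. y \<le> u} < card {y \<in> A. y \<le> v}"
  show "u < v"
  proof (rule ccontr)
    assume "\<not> u < v"
    then have "card {y \<in> A. y \<le> v} \<le> card {y \<in> A. y \<le> u}"
      using assms by (intro card_mono) auto
    with less show False by simp
  qed
qed

lemma flatten_nth_less_iff:
  assumes "a < length xs" "b < length xs"
  shows "flatten xs ! a < flatten xs ! b \<longleftrightarrow> xs ! a < xs ! b"
  using assms rank_less_iff[of "set xs" "xs ! b"] by (simp add: flatten_def)

lemma increasing_upto_restrict_perm:
  assumes "i \<le> k"
  shows "increasing_upto i (restrict_perm xs k) \<longleftrightarrow> increasing_upto i xs"
proof -
  have "restrict_perm xs k ! a < restrict_perm xs k ! b \<longleftrightarrow> xs ! a < xs ! b"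
    if "a < b" "b < i" "b < length xs" for a b
    using flatten_nth_less_iff[of a "take k xs" b] that assms by (simp add: restrict_perm_def)
  then show ?thesis
    using assms unfolding increasing_upto_def by auto
qed

lemma has_inversion_not_increasing:
  "has_inversion p \<Longrightarrow> length p \<le> k \<Longrightarrow> \<not> increasing_upto k p"
  unfolding has_inversion_def increasing_upto_def by (metis less_le_trans not_less_iff_gr_or_eq)

text \<open>In an increasing list the entries up to \<open>xs ! j\<close> are exactly those at the
  indices \<open>0\<close> to \<open>j\<close>, so the rank is \<open>j + 1\<close>.\<close>

lemma flatten_increasing:
  assumes "increasing_upto (length xs) xs"
  shows "flatten xs = [1..<Suc (length xs)]"
proof (rule nth_equalityI)
  fix j assume "j < length (flatten xs)"
  then have j: "j < length xs" by simp
  have less: "xs ! a < xs ! b" if "a < b" "b < length xs" for a b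
    using assms that by (simp add: increasing_upto_def)
  have "{y \<in> set xs. y \<le> xs ! j} = (!) xs ` {..j}"
  proof (intro equalityI subsetI)
    fix y assume "y \<in> {y \<in> set xs. y \<le> xs ! j}"
    then obtain a where "a < length xs" "y = xs ! a" "xs ! a \<le> xs ! j"
      by (auto simp: in_set_conv_nth)
    then show "y \<in> (!) xs ` {..j}"
      using less[of j a] by (cases "a \<le> j") auto
  next
    fix y assume "y \<in> (!) xs ` {..j}"
    then obtain a where "a \<le> j" "y = xs ! a" by auto
    then show "y \<in> {y \<in> set xs. y \<le> xs ! j}"
      using less[of a j] j by (cases "a = j") auto
  qed
  moreover have "inj_on ((!) xs) {..j}"
    by (rule linorder_inj_onI) (use less j in \<open>force+\<close>)
  ultimately show "flatten xs ! j = [1..<Suc (length xs)] ! j"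
    using j by (simp add: flatten_def card_image del: upt_Suc)
qed (simp del: upt_Suc)

text \<open>Lets part (2) work with monotonicity of the first \<open>k\<close> entries instead of
  flattened prefixes.\<close>

lemma restrict_perm_eq_upt_iff:
  assumes "k \<le> length xs"
  shows "restrict_perm xs k = [1..<k+1] \<longleftrightarrow> increasing_upto k xs"
proof
  assume eq: "restrict_perm xs k = [1..<k+1]"
  have "increasing_upto k [1..<k+1]"
    by (auto simp: increasing_upto_def simp del: upt_Suc)
  then show "increasing_upto k xs"
    using increasing_upto_restrict_perm[of k k xs] eq by simp
next
  assume "increasing_upto k xs"
  then have "increasing_upto (length (take k xs)) (take k xs)"
    by (simp add: increasing_upto_def)
  from flatten_increasing[OF this] assms show "restrict_perm xs k = [1..<k+1]"
    by (simp add: restrict_perm_def min_def)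
qed

text \<open>Ranks embed the order, so ranking them again changes nothing. Needed because
  \<open>remove_one\<close> flattens what is already a flattened prefix.\<close>

lemma flatten_idem: "flatten (flatten xs) = flatten xs"
proof -
  define r where "r x = card {y \<in> set xs. y \<le> x}" for x
  have r: "r u \<le> r v \<longleftrightarrow> u \<le> v" if "u \<in> set xs" "v \<in> set xs" for u v
    using rank_less_iff[of "set xs" u v] that by (simp add: r_def not_less[symmetric])
  have "card {y \<in> r ` set xs. y \<le> r x} = r x" if "x \<in> set xs" for x
  proof -
    have "{y \<in> r ` set xs. y \<le> r x} = r ` {y \<in> set xs. y \<le> x}"
      using r that by auto
    moreover have "inj_on r {y \<in> set xs. y \<le> x}"
      by (rule inj_onI) (metis (no_types, lifting) mem_Collect_eq r antisym order_refl)
    ultimately show ?thesis by (simp add: card_image flip: r_def)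
  qed
  then show ?thesis
    by (simp add: flatten_def flip: r_def)
qed

lemma flatten_pos: "0 \<notin> set (flatten xs)"
  by (auto simp: flatten_def)

lemma set_insert_one: "set (insert_one i xs) = insert 1 (Suc ` set xs)"
proof -
  have "set (take i xs) \<union> set (drop i xs) = set xs"
    by (metis append_take_drop_id set_append)
  then show ?thesis by (auto simp: insert_one_def)
qed

text \<open>Without 0 in \<open>xs\<close> the new 1 is strictly smallest: it gets rank 1, and every
  other rank rises by one.\<close>

lemma flatten_insert_one:
  assumes "0 \<notin> set xs"
  shows "flatten (insert_one i xs) = insert_one i (flatten xs)"
proof -
  have "card {y \<in> insert 1 (Suc ` set xs). y \<le> Suc x} = Suc (card {y \<in> set xs. y \<le> x})" for x
  proof -
    have "{y \<in> insert 1 (Suc ` set xs). y \<le> Suc x} = insert 1 (Suc ` {y \<in> set xs. y \<le> x})"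
      by auto
    then show ?thesis using assms by (simp add: card_insert_if image_iff card_image)
  qed
  moreover have "{y \<in> insert 1 (Suc ` set xs). y \<le> 1} = {1}"
    using assms by (auto simp: Suc_le_eq)
  ultimately show ?thesis
    unfolding flatten_def set_insert_one by (simp add: insert_one_def take_map drop_map)
qed

subsection \<open>Inserting the value 1\<close>

lemma length_insert_one [simp]: "length (insert_one i xs) = Suc (length xs)"
  by (simp add: insert_one_def)

lemma nth_insert_one:
  assumes "i \<le> length xs" "j \<le> length xs"
  shows "insert_one i xs ! j = (if j < i then Suc (xs ! j) else if j = i then 1 else Suc (xs ! (j - 1)))"
  using assms by (auto simp: insert_one_def nth_append nth_Cons' min_def)

text \<open>Without zeros the inserted 1 is the only 1, so its place can be read off. The length
  bounds matter because every larger index also puts 1 at the end.\<close>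

lemma insert_one_inject:
  assumes eq: "insert_one i xs = insert_one i' ys"
    and "i \<le> length xs" "i' \<le> length ys" "0 \<notin> set xs" "0 \<notin> set ys"
  shows "i = i' \<and> xs = ys"
proof -
  have "1 \<notin> set (map Suc (take i xs))" "1 \<notin> set (map Suc (take i' ys))"
       "1 \<notin> set (map Suc (drop i xs))" "1 \<notin> set (map Suc (drop i' ys))"
    using assms(4,5) by (auto dest: in_set_takeD in_set_dropD)
  with eq have t: "map Suc (take i xs) = map Suc (take i' ys)"
    and d: "map Suc (drop i xs) = map Suc (drop i' ys)"
    unfolding insert_one_def by (auto dest: append_Cons_eq_iff[THEN iffD1, rotated 2])
  from t have "take i xs = take i' ys" by (simp add: inj_map_eq_map)
  moreover from d have "drop i xs = drop i' ys" by (simp add: inj_map_eq_map)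
  moreover have "i = i'"
    using arg_cong[OF t, of length] assms(2,3) by simp
  ultimately show ?thesis by (metis append_take_drop_id)
qed

text \<open>The bound \<open>i \<le> k\<close> keeps the inserted 1 among the first
  \<open>k + 1\<close> entries, so truncation and insertion commute.\<close>

lemma restrict_perm_insert_one:
  assumes "i \<le> k" "0 \<notin> set xs" "i \<le> length xs"
  shows "restrict_perm (insert_one i xs) (Suc k) = insert_one i (restrict_perm xs k)"
proof -
  have "take (Suc k) (insert_one i xs) = insert_one i (take k xs)"
    using assms by (simp add: insert_one_def take_map drop_map take_drop min_def Suc_diff_le)
  moreover have "0 \<notin> set (take k xs)"
    using assms(2) by (auto dest: in_set_takeD)
  ultimately show ?thesis
    by (simp add: restrict_perm_def flatten_insert_one)
qed

lemma flatten_map_Suc: "flatten (map Suc xs) = flatten xs"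
proof -
  have "{y \<in> Suc ` set xs. y \<le> Suc x} = Suc ` {y \<in> set xs. y \<le> x}" for x by auto
  then show ?thesis by (simp add: flatten_def card_image)
qed

lemma remove_one_insert_one:
  assumes "0 \<notin> set xs"
  shows "remove_one (insert_one i xs) = flatten xs"
proof -
  have "filter (\<lambda>x. x \<noteq> 1) (map Suc (take i xs)) = map Suc (take i xs)"
       "filter (\<lambda>x. x \<noteq> 1) (map Suc (drop i xs)) = map Suc (drop i xs)"
    using assms by (auto simp: filter_id_conv intro!: gr0I dest: in_set_takeD in_set_dropD)
  then have "filter (\<lambda>x. x \<noteq> 1) (insert_one i xs) = map Suc xs"
    by (simp add: insert_one_def flip: map_append)
  then show ?thesis by (simp add: remove_one_def flatten_map_Suc)
qed

text \<open>The smallest value can only be the last entry of a 321 pattern, so the inserted 1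
  creates one exactly when an inversion stands to its left.\<close>

lemma avoids_321_insert_one:
  assumes i: "i \<le> length xs" and "distinct xs" "0 \<notin> set xs"
  shows "avoids_321 (insert_one i xs) \<longleftrightarrow> avoids_321 xs \<and> increasing_upto i xs"
proof (intro iffI conjI)
  assume av: "avoids_321 (insert_one i xs)"
  \<comment> \<open>\<open>s\<close> sends an index of \<open>xs\<close> to the index of the same
    entry after insertion.\<close>
  define s where "s j = (if j < i then j else Suc j)" for j
  have s: "insert_one i xs ! s j = Suc (xs ! j)" "s j < Suc (length xs)" if "j < length xs" for j
    using i that by (auto simp: s_def nth_insert_one)
  have s_mono: "s a < s b" if "a < b" for a b
    using that by (auto simp: s_def)
  show "avoids_321 xs"
    unfolding avoids_321_def
  proof clarify
    fix a b c assume "a < b" "b < c" "c < length xs" "xs ! b < xs ! a" "xs ! c < xs ! b"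
    then have "s a < s b \<and> s b < s c \<and> s c < length (insert_one i xs) \<and>
       insert_one i xs ! s b < insert_one i xs ! s a \<and> insert_one i xs ! s c < insert_one i xs ! s b"
      using s s_mono by simp
    with av show False unfolding avoids_321_def by blast
  qed
  show "increasing_upto i xs"
    unfolding increasing_upto_def
  proof clarify
    fix a b assume ab: "a < b" "b < i" "b < length xs"
    show "xs ! a < xs ! b"
    proof (rule ccontr)
      assume "\<not> xs ! a < xs ! b"
      moreover have "xs ! a \<noteq> xs ! b"
        using ab assms(2) by (simp add: nth_eq_iff_index_eq)
      moreover have "xs ! b \<noteq> 0" using ab assms(3) by (metis nth_mem)
      ultimately have "a < b \<and> b < i \<and> i < length (insert_one i xs) \<and>
         insert_one i xs ! b < insert_one i xs ! a \<and> insert_one i xs ! i < insert_one i xs ! b"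
        using ab i by (auto simp: nth_insert_one)
      with av show False unfolding avoids_321_def by blast
    qed
  qed
next
  assume av: "avoids_321 xs \<and> increasing_upto i xs"
  \<comment> \<open>\<open>t\<close> undoes this shift at all indices other than
    \<open>i\<close>.\<close>
  define t where "t j = (if j < i then j else j - 1)" for j
  have t: "insert_one i xs ! j = Suc (xs ! t j)" "t j < length xs"
    if "j \<le> length xs" "j \<noteq> i" for j
    using i that by (auto simp: t_def nth_insert_one)
  have t_mono: "t a < t b" if "a < b" "a \<noteq> i" "b \<noteq> i" for a b
    using that by (auto simp: t_def)
  show "avoids_321 (insert_one i xs)"
    unfolding avoids_321_def
  proof clarify
    fix a b c assume abc: "a < b" "b < c" "c < length (insert_one i xs)"
      and gt: "insert_one i xs ! b < insert_one i xs ! a" "insert_one i xs ! c < insert_one i xs ! b"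
    have pos: "insert_one i xs ! j \<ge> 1" if "j \<le> length xs" for j
      using that i by (simp add: nth_insert_one)
    \<comment> \<open>The two larger entries of the pattern exceed 1, so only \<open>c\<close> can
      be the inserted position.\<close>
    have "insert_one i xs ! b > 1" "insert_one i xs ! a > 1"
      using pos[of c] pos[of b] abc gt by auto
    moreover have "insert_one i xs ! i = 1" using i by (simp add: nth_insert_one)
    ultimately have ne: "a \<noteq> i" "b \<noteq> i" by auto
    show False
    proof (cases "c = i")
      case True
      then have "xs ! a < xs ! b"
        using av abc i by (simp add: increasing_upto_def)
      then show False
        using gt abc True i by (simp add: nth_insert_one)
    next
      case False
      have "t a < t b \<and> t b < t c \<and> t c < length xs \<and> xs ! t b < xs ! t a \<and> xs ! t c < xs ! t b"
        using t[of a] t[of b] t[of c] t_mono ne False abc gt by simp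
      with av show False unfolding avoids_321_def by blast
    qed
  qed
qed

section \<open>Decomposition of 321-avoiding permutations by the position of 1\<close>

lemma Av321_D:
  assumes "\<sigma> \<in> Av321 N"
  shows "length \<sigma> = N" "distinct \<sigma>" "set \<sigma> = {1..N}" "0 \<notin> set \<sigma>" "avoids_321 \<sigma>"
proof -
  from assms show "distinct \<sigma>" "set \<sigma> = {1..N}" "avoids_321 \<sigma>"
    by (auto simp: Av321_def permutations_of_set_def)
  then show "0 \<notin> set \<sigma>" "length \<sigma> = N"
    using distinct_card[of \<sigma>] by auto
qed

lemma finite_Av321: "finite (Av321 N)"
  by (simp add: Av321_def)

lemma insert_one_in_Av321:
  assumes "\<sigma> \<in> Av321 N" "i \<le> N" "increasing_upto i \<sigma>"
  shows "insert_one i \<sigma> \<in> Av321 (Suc N)"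
proof -
  note \<sigma> = Av321_D[OF assms(1)]
  have "insert 1 (Suc ` {1..N}) = {1..Suc N}"
    by (auto simp: image_Suc_atLeastAtMost)
  then have "set (insert_one i \<sigma>) = {1..Suc N}"
    using \<sigma>(3) by (simp add: set_insert_one)
  \<comment> \<open>A list of length \<open>Suc N\<close> with \<open>Suc N\<close> different values
    has no repetitions.\<close>
  moreover from this have "distinct (insert_one i \<sigma>)"
    using \<sigma>(1) by (intro card_distinct) simp
  ultimately show ?thesis
    using avoids_321_insert_one[of i \<sigma>] \<sigma> assms
    by (simp add: Av321_def permutations_of_set_def)
qed

text \<open>Surjectivity of the decomposition: cutting out the 1 and lowering all other entries
  inverts \<open>insert_one\<close>.\<close>

lemma Av321_Suc_cases:
  assumes "\<pi> \<in> Av321 (Suc N)"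
  obtains i \<sigma> where "i \<le> N" "\<sigma> \<in> Av321 N" "increasing_upto i \<sigma>" "\<pi> = insert_one i \<sigma>"
proof -
  note \<pi> = Av321_D[OF assms]
  have "1 \<in> set \<pi>" using \<pi>(3) by simp
  then obtain xs ys where split: "\<pi> = xs @ 1 # ys" by (meson split_list)
  define \<sigma> where "\<sigma> = map (\<lambda>x. x - 1) (xs @ ys)"
  have pos: "\<forall>x \<in> set (xs @ ys). Suc (x - 1) = x"
    using \<pi>(4) split by (auto intro!: Suc_pred gr0I)
  then have \<pi>_eq: "\<pi> = insert_one (length xs) \<sigma>"
    unfolding insert_one_def \<sigma>_def split by (simp add: map_idI)
  have "set (xs @ ys) = {1..Suc N} - {1}"
    using \<pi>(2,3) split by auto
  also have "\<dots> = Suc ` {1..N}"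
    by (auto simp: image_Suc_atLeastAtMost)
  finally have "set \<sigma> = {1..N}"
    unfolding \<sigma>_def set_map by (simp only: image_image diff_Suc_1 image_ident)
  moreover have "distinct \<sigma>"
    unfolding \<sigma>_def distinct_map
  proof
    show "distinct (xs @ ys)" using \<pi>(2) split by simp
    show "inj_on (\<lambda>x. x - 1) (set (xs @ ys))"
      by (rule inj_on_inverseI[where g = Suc]) (use pos in blast)
  qed
  ultimately have *: "\<sigma> \<in> permutations_of_set {1..N}"
    by (simp add: permutations_of_set_def)
  have len: "length xs \<le> length \<sigma>" "length \<sigma> = N"
    using \<pi>(1) split by (auto simp: \<sigma>_def)
  then have "avoids_321 \<sigma> \<and> increasing_upto (length xs) \<sigma>"
    using avoids_321_insert_one[of "length xs" \<sigma>] \<open>distinct \<sigma>\<close> \<open>set \<sigma> = {1..N}\<close> \<pi>(5) \<pi>_eq by simp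
  with * len \<pi>_eq show ?thesis
    by (intro that[of "length xs" \<sigma>]) (auto simp: Av321_def)
qed

text \<open>The bound on \<open>i\<close> sits inside the set, so the statement holds for every
  \<open>i\<close>; beyond \<open>N\<close> the set is empty.\<close>

lemma inj_on_insert_one: "inj_on (insert_one i) {\<sigma> \<in> Av321 N. i \<le> N \<and> P \<sigma>}"
  by (rule inj_onI) (use insert_one_inject Av321_D in blast)

text \<open>Source of all counting recurrences below: the permutations are split by the index
  \<open>i\<close> of the value 1, and the classes are disjoint because \<open>i\<close> can be
  recovered.\<close>

lemma card_Av321_Suc:
  "card {\<pi> \<in> Av321 (Suc N). P \<pi>} =
     (\<Sum>i\<le>N. card {\<sigma> \<in> Av321 N. increasing_upto i \<sigma> \<and> P (insert_one i \<sigma>)})"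
proof -
  define A where "A i = {\<sigma> \<in> Av321 N. i \<le> N \<and> increasing_upto i \<sigma> \<and> P (insert_one i \<sigma>)}" for i
  have "{\<pi> \<in> Av321 (Suc N). P \<pi>} = (\<Union>i\<in>{..N}. insert_one i ` A i)"
    by (auto simp: A_def insert_one_in_Av321 elim!: Av321_Suc_cases)
  also have "card \<dots> = (\<Sum>i\<le>N. card (insert_one i ` A i))"
  proof (rule card_UN_disjoint)
    show "\<forall>i\<in>{..N}. finite (insert_one i ` A i)"
      by (simp add: A_def finite_Av321)
    show "\<forall>i\<in>{..N}. \<forall>j\<in>{..N}. i \<noteq> j \<longrightarrow> insert_one i ` A i \<inter> insert_one j ` A j = {}"
      by (auto simp: A_def dest!: insert_one_inject dest: Av321_D)
  qed simp
  also have "\<dots> = (\<Sum>i\<le>N. card (A i))"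
    unfolding A_def by (intro sum.cong refl card_image inj_on_insert_one)
  finally show ?thesis by (simp add: A_def cong: conj_cong)
qed

text \<open>A leading 1 does no harm and uses up one place of the run. Anywhere else the 1 lies
  below the first entry, so the run must end before it.\<close>

lemma increasing_upto_insert_one:
  assumes "increasing_upto i xs" "i \<le> length xs" "0 \<notin> set xs"
  shows "increasing_upto (Suc k) (insert_one i xs) \<longleftrightarrow> (if i = 0 then increasing_upto k xs else k < i)"
proof (cases "i = 0")
  case True
  have "increasing_upto (Suc k) (1 # map Suc xs) \<longleftrightarrow> increasing_upto k xs"
  proof
    assume inc: "increasing_upto (Suc k) (1 # map Suc xs)"
    show "increasing_upto k xs"
      unfolding increasing_upto_def
    proof clarify
      fix a b assume "a < b" "b < k" "b < length xs"
      then show "xs ! a < xs ! b"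
        using inc[unfolded increasing_upto_def, rule_format, of "Suc a" "Suc b"] by simp
    qed
  next
    assume "increasing_upto k xs"
    moreover have "0 < xs ! b" if "b < length xs" for b
      using assms(3) that by (metis gr0I nth_mem)
    ultimately show "increasing_upto (Suc k) (1 # map Suc xs)"
      unfolding increasing_upto_def by (auto simp: nth_Cons' less_Suc_eq_0_disj)
  qed
  with True show ?thesis by (simp add: insert_one_def)
next
  case False
  have "\<not> increasing_upto (Suc k) (insert_one i xs)" if "i \<le> k"
  proof -
    have "0 < i \<and> i < Suc k \<and> i < length (insert_one i xs) \<and>
        \<not> insert_one i xs ! 0 < insert_one i xs ! i"
      using False assms(2) that by (simp add: nth_insert_one)
    then show ?thesis unfolding increasing_upto_def by blast
  qed
  moreover have "increasing_upto (Suc k) (insert_one i xs)" if "k < i"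
    using assms(1,2) that by (auto simp: increasing_upto_def nth_insert_one)
  ultimately show ?thesis using False by (cases "k < i") simp_all
qed

section \<open>Left-to-right maxima under insertion of 1\<close>

lemma lr_max_insert_one:
  assumes "i \<le> j" "i \<le> length xs" "0 \<notin> set xs"
  shows "lr_max (insert_one i xs) (Suc j) \<longleftrightarrow> lr_max xs j"
proof
  assume lr: "lr_max (insert_one i xs) (Suc j)"
  then have j: "j < length xs" by (simp add: lr_max_def)
  show "lr_max xs j"
    unfolding lr_max_def
  proof (intro conjI allI impI j)
    fix l assume "l < j"
    then have "insert_one i xs ! (if l < i then l else Suc l) < insert_one i xs ! Suc j"
      using lr by (simp add: lr_max_def)
    then show "xs ! l < xs ! j"
      using \<open>l < j\<close> j assms by (simp add: nth_insert_one split: if_splits)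
  qed
next
  assume lr: "lr_max xs j"
  then have j: "j < length xs" by (simp add: lr_max_def)
  \<comment> \<open>Positivity lets the raised entry exceed the inserted 1 as well.\<close>
  then have "0 < xs ! j" using assms(3) by (metis gr0I nth_mem)
  then show "lr_max (insert_one i xs) (Suc j)"
    using lr j assms by (auto simp: lr_max_def nth_insert_one)
qed

lemma ex_ge_Suc_iff: "(\<exists>j\<ge>Suc k. P j) \<longleftrightarrow> (\<exists>j\<ge>k. P (Suc j))"
  by (metis Suc_le_D Suc_le_mono)

text \<open>All entries searched stand behind the inserted 1, so their indices and values both move
  up by one.\<close>

lemma next_max_at_insert_one:
  assumes "i \<le> k" "i \<le> length xs" "0 \<notin> set xs"
  shows "next_max_at (Suc k) (Suc v) (insert_one i xs) \<longleftrightarrow> next_max_at k v xs"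
proof -
  have "lr_max (insert_one i xs) (Suc j) \<and>
        (\<forall>l. Suc k \<le> l \<and> l < Suc j \<longrightarrow> \<not> lr_max (insert_one i xs) l) \<and> insert_one i xs ! Suc j = Suc v
    \<longleftrightarrow> lr_max xs j \<and> (\<forall>l. k \<le> l \<and> l < j \<longrightarrow> \<not> lr_max xs l) \<and> xs ! j = v" if "k \<le> j" for j
  proof -
    have "(\<forall>l. Suc k \<le> l \<and> l < Suc j \<longrightarrow> \<not> lr_max (insert_one i xs) l) \<longleftrightarrow>
          (\<forall>l. k \<le> l \<and> l < j \<longrightarrow> \<not> lr_max (insert_one i xs) (Suc l))"
      using ex_ge_Suc_iff[of k "\<lambda>l. l < Suc j \<and> lr_max (insert_one i xs) l"] by auto
    also have "\<dots> \<longleftrightarrow> (\<forall>l. k \<le> l \<and> l < j \<longrightarrow> \<not> lr_max xs l)"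
      using assms by (simp add: lr_max_insert_one)
    moreover have "j < length xs \<Longrightarrow> insert_one i xs ! Suc j = Suc (xs ! j)"
      using assms that by (simp add: nth_insert_one)
    moreover have "lr_max (insert_one i xs) (Suc j) \<longleftrightarrow> lr_max xs j"
      using assms that by (simp add: lr_max_insert_one)
    moreover have "lr_max xs j \<Longrightarrow> j < length xs"
      by (simp add: lr_max_def)
    ultimately show ?thesis by auto
  qed
  then show ?thesis
    unfolding next_max_at_def ex_ge_Suc_iff by (metis (lifting))
qed

lemma next_max_at_Suc:
  assumes "\<not> lr_max xs k"
  shows "next_max_at k v xs \<longleftrightarrow> next_max_at (Suc k) v xs"
proof -
  have "(\<forall>i. k \<le> i \<and> i < j \<longrightarrow> \<not> lr_max xs i) \<longleftrightarrow> (\<forall>i. Suc k \<le> i \<and> i < j \<longrightarrow> \<not> lr_max xs i)" for j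
    using assms by (metis Suc_leD le_antisym not_less_eq_eq)
  moreover have "k \<le> j \<and> lr_max xs j \<longleftrightarrow> Suc k \<le> j \<and> lr_max xs j" for j
    using assms by (cases "j = k") auto
  ultimately show ?thesis
    unfolding next_max_at_def by (metis (lifting))
qed

text \<open>Here 1 is the first entry searched. As \<open>k > 0\<close>, it is not a left-to-right
  maximum and is skipped, so the start stays at \<open>k\<close> while the value moves.\<close>

lemma next_max_at_insert_one_same:
  assumes "0 < k" "k \<le> length xs" "0 \<notin> set xs"
  shows "next_max_at k (Suc v) (insert_one k xs) \<longleftrightarrow> next_max_at k v xs"
proof -
  have "insert_one k xs ! k \<le> insert_one k xs ! 0"
    using assms by (simp add: nth_insert_one)
  then have "\<not> lr_max (insert_one k xs) k"
    using assms(1) by (auto simp: lr_max_def not_less)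
  then show ?thesis
    using assms by (simp add: next_max_at_Suc next_max_at_insert_one)
qed

lemma next_max_at_lr_max:
  assumes "lr_max xs k"
  shows "next_max_at k v xs \<longleftrightarrow> xs ! k = v"
proof
  assume "next_max_at k v xs"
  then obtain j where "k \<le> j" "\<forall>i. k \<le> i \<and> i < j \<longrightarrow> \<not> lr_max xs i" "xs ! j = v"
    by (auto simp: next_max_at_def)
  with assms show "xs ! k = v" by (cases "k = j") auto
qed (use assms in \<open>auto simp: next_max_at_def\<close>)

subsection \<open>Prefixes with an inversion\<close>

lemma trigger_prob_inversion:
  assumes p: "p \<in> Av321_prefixes (Suc N) k" "has_inversion p" and k: "k \<le> N"
  shows "trigger_prob (Suc N) p = trigger_prob N (remove_one p)"
proof -
  \<comment> \<open>With 1 at index \<open>k\<close> or later, the first \<open>k\<close> entries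
    would be increasing, against the inversion in \<open>p\<close>.\<close>
  have small: "i < k" if "\<sigma> \<in> Av321 N" "i \<le> N" "increasing_upto i \<sigma>"
    "restrict_perm (insert_one i \<sigma>) k = p" for i \<sigma>
  proof (rule ccontr)
    assume "\<not> i < k"
    then have "increasing_upto k (insert_one i \<sigma>)"
      using that Av321_D(1)[OF that(1)] by (auto simp: increasing_upto_def nth_insert_one)
    then have "increasing_upto k p"
      using that(4) increasing_upto_restrict_perm[of k k] by blast
    moreover have "length p \<le> k" using that(4) by auto
    ultimately show False using has_inversion_not_increasing p(2) by blast
  qed
  \<comment> \<open>One permutation with prefix \<open>p\<close> fixes the index \<open>i\<close> of
    1 and the reduced prefix \<open>q\<close>.\<close>
  from p(1) obtain \<pi>0 where "\<pi>0 \<in> Av321 (Suc N)" "restrict_perm \<pi>0 k = p"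
    by (auto simp: Av321_prefixes_def)
  then obtain i \<tau> where i: "i \<le> N" and \<tau>: "\<tau> \<in> Av321 N" "increasing_upto i \<tau>"
    and p_eq: "restrict_perm (insert_one i \<tau>) k = p"
    by (auto elim!: Av321_Suc_cases)
  note ik = small[OF \<tau>(1) i \<tau>(2) p_eq]
  define m where "m = k - 1"
  have m: "k = Suc m" "i \<le> m" "m < N" using ik k by (auto simp: m_def)
  define q where "q = restrict_perm \<tau> m"
  have q_pos: "0 \<notin> set q" by (simp add: q_def restrict_perm_def flatten_pos)
  have len: "length q = m" using Av321_D(1)[OF \<tau>(1)] m by (simp add: q_def)
  have pq: "p = insert_one i q"
    using p_eq restrict_perm_insert_one[of i m \<tau>] Av321_D[OF \<tau>(1)] m i by (simp add: q_def)
  have rq: "remove_one p = q"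
    unfolding pq remove_one_insert_one[OF q_pos] by (simp add: q_def restrict_perm_def flatten_idem)
  have inc_q: "increasing_upto i q"
    using \<tau>(2) m by (simp add: q_def increasing_upto_restrict_perm)
  \<comment> \<open>\<open>P\<close> is kept arbitrary: the winning condition gives the numerator
    and \<open>True\<close> the denominator.\<close>
  have image: "{\<pi> \<in> Av321 (Suc N). restrict_perm \<pi> k = p \<and> P \<pi>} =
      insert_one i ` {\<sigma> \<in> Av321 N. i \<le> N \<and> restrict_perm \<sigma> m = q \<and> P (insert_one i \<sigma>)}" for P
  proof (intro equalityI subsetI)
    fix \<pi> assume "\<pi> \<in> {\<pi> \<in> Av321 (Suc N). restrict_perm \<pi> k = p \<and> P \<pi>}"
    then obtain i' \<sigma> where \<sigma>: "i' \<le> N" "\<sigma> \<in> Av321 N" "increasing_upto i' \<sigma>"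
      "\<pi> = insert_one i' \<sigma>" "restrict_perm (insert_one i' \<sigma>) k = p" "P (insert_one i' \<sigma>)"
      by (auto elim!: Av321_Suc_cases)
    have i': "i' \<le> m" using small[OF \<sigma>(2,1,3,5)] m(1) by simp
    \<comment> \<open>Both sides are the prefix \<open>p\<close>, so injectivity forces 1 to the
      same index \<open>i\<close> in every permutation with this prefix.\<close>
    then have "insert_one i' (restrict_perm \<sigma> m) = insert_one i q"
      using restrict_perm_insert_one[of i' m \<sigma>] Av321_D[OF \<sigma>(2)] \<sigma>(1,5) m(1) pq by simp
    then have "i' = i \<and> restrict_perm \<sigma> m = q"
      by (rule insert_one_inject)
         (use i' m len q_pos Av321_D(1)[OF \<sigma>(2)] in \<open>auto simp: restrict_perm_def flatten_pos\<close>)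
    then show "\<pi> \<in> insert_one i ` {\<sigma> \<in> Av321 N. i \<le> N \<and> restrict_perm \<sigma> m = q \<and> P (insert_one i \<sigma>)}"
      using \<sigma> by blast
  next
    fix \<pi> assume "\<pi> \<in> insert_one i ` {\<sigma> \<in> Av321 N. i \<le> N \<and> restrict_perm \<sigma> m = q \<and> P (insert_one i \<sigma>)}"
    then obtain \<sigma> where \<sigma>: "\<sigma> \<in> Av321 N" "restrict_perm \<sigma> m = q" "P (insert_one i \<sigma>)"
      "\<pi> = insert_one i \<sigma>" by blast
    \<comment> \<open>Since \<open>i \<le> m\<close>, this can be read off from the prefix
      \<open>q\<close> alone.\<close>
    have "increasing_upto i \<sigma>"
      using inc_q m \<sigma>(2) increasing_upto_restrict_perm[of i m \<sigma>] by simp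
    then have "insert_one i \<sigma> \<in> Av321 (Suc N)"
      using \<sigma>(1) i by (rule insert_one_in_Av321[rotated 2])
    moreover have "restrict_perm (insert_one i \<sigma>) k = p"
      using restrict_perm_insert_one[of i m \<sigma>] Av321_D[OF \<sigma>(1)] m i \<sigma>(2) pq by simp
    ultimately show "\<pi> \<in> {\<pi> \<in> Av321 (Suc N). restrict_perm \<pi> k = p \<and> P \<pi>}"
      using \<sigma> by simp
  qed
  have card: "card {\<pi> \<in> Av321 (Suc N). restrict_perm \<pi> k = p \<and> P \<pi>} =
      card {\<sigma> \<in> Av321 N. restrict_perm \<sigma> m = q \<and> P (insert_one i \<sigma>)}" for P
    unfolding image card_image[OF inj_on_insert_one] using i by simp
  have "next_max_at k (Suc N) (insert_one i \<sigma>) \<longleftrightarrow> next_max_at m N \<sigma>" if "\<sigma> \<in> Av321 N" for \<sigma>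
    using next_max_at_insert_one[of i m \<sigma>] Av321_D[OF that] m i by simp
  then have "card {\<pi> \<in> Av321 (Suc N). restrict_perm \<pi> k = p \<and> next_max_at k (Suc N) \<pi>} =
      card {\<sigma> \<in> Av321 N. restrict_perm \<sigma> m = q \<and> next_max_at m N \<sigma>}"
    unfolding card by (metis (lifting))
  moreover have "length p = k" using len m pq by simp
  ultimately show ?thesis
    unfolding trigger_prob_def rq won_by_triggering_iff
    using card[of "\<lambda>_. True"] len by simp
qed

subsection \<open>Increasing prefixes\<close>

lemma Av321_0: "Av321 0 = {[]}"
  by (auto simp: Av321_def avoids_321_def)

text \<open>Only \<open>i = 0\<close> and \<open>i > k\<close> are possible. The case
  \<open>i = 0\<close> contributes the count for \<open>k\<close>, which is just the term that
  starts the sum at \<open>k\<close>.\<close>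

lemma card_increasing_Suc:
  assumes "k \<le> N"
  shows "card {\<pi> \<in> Av321 (Suc N). increasing_upto (Suc k) \<pi>} =
    (\<Sum>i=k..N. card {\<sigma> \<in> Av321 N. increasing_upto i \<sigma>})"
proof -
  define D where "D i = card {\<sigma> \<in> Av321 N. increasing_upto i \<sigma>}" for i
  have summand: "card {\<sigma> \<in> Av321 N. increasing_upto i \<sigma> \<and> increasing_upto (Suc k) (insert_one i \<sigma>)} =
     (if i = 0 then D k else if k < i then D i else 0)" if "i \<le> N" for i
  proof -
    have "{\<sigma> \<in> Av321 N. increasing_upto i \<sigma> \<and> increasing_upto (Suc k) (insert_one i \<sigma>)} =
      {\<sigma> \<in> Av321 N. increasing_upto i \<sigma> \<and> (if i = 0 then increasing_upto k \<sigma> else k < i)}"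
      using that by (auto simp: increasing_upto_insert_one Av321_D)
    moreover have "increasing_upto 0 \<sigma>" for \<sigma> by (simp add: increasing_upto_def)
    ultimately show ?thesis by (auto simp: D_def)
  qed
  have "card {\<pi> \<in> Av321 (Suc N). increasing_upto (Suc k) \<pi>} =
     (\<Sum>i\<in>{..N}. if i = 0 then D k else if k < i then D i else 0)"
    unfolding card_Av321_Suc by (intro sum.cong) (simp_all add: summand)
  also have "\<dots> = D k + (\<Sum>i\<in>{..N} - {0}. if k < i then D i else 0)"
    by (subst sum.remove[of _ 0]) (auto intro: sum.cong)
  also have "(\<Sum>i\<in>{..N} - {0}. if k < i then D i else 0) = (\<Sum>i\<in>{Suc k..N}. D i)"
    by (rule sum.mono_neutral_cong_right) auto
  finally show ?thesis
    using assms by (simp add: D_def sum.atLeast_Suc_atMost)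
qed

text \<open>The ballot numbers, with the Catalan number at \<open>k = 0\<close>. Real values make
  the division exact.\<close>

definition ballot :: "nat \<Rightarrow> nat \<Rightarrow> real" where
  "ballot N k = (real k + 1) / (real N + 1) * real ((2 * N - k) choose N)"

text \<open>All three terms are rational multiples of one binomial coefficient \<open>c\<close>,
  which leaves a polynomial identity.\<close>

lemma ballot_rec:
  assumes "k < N"
  shows "ballot (Suc N) (Suc k) = ballot N k + ballot (Suc N) (Suc (Suc k))"
proof -
  define m where "m = 2 * N - k"
  define c where "c = real (m choose N)"
  have m: "real m = 2 * real N - real k" using assms by (simp add: m_def)
  have "Suc N * (Suc m choose Suc N) = Suc m * (m choose N)"
    using Suc_times_binomial_eq[of m N] by (simp add: mult.commute)
  then have "real (Suc N) * real (Suc m choose Suc N) = real (Suc m) * c"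
    unfolding c_def by (metis of_nat_mult)
  then have 1: "real (Suc m choose Suc N) = (real m + 1) * c / (real N + 1)"
    by (simp add: field_simps)
  \<comment> \<open>Pascal's rule, subtracting \<open>c\<close> from the preceding value.\<close>
  then have 2: "real (m choose Suc N) = (real m - real N) * c / (real N + 1)"
    by (simp add: c_def field_simps)
  have "2 * Suc N - Suc k = Suc m" "2 * Suc N - Suc (Suc k) = m"
    using assms by (auto simp: m_def)
  then have b: "ballot (Suc N) (Suc k) = (real k + 2) / (real N + 2) * ((real m + 1) * c / (real N + 1))"
    "ballot (Suc N) (Suc (Suc k)) = (real k + 3) / (real N + 2) * ((real m - real N) * c / (real N + 1))"
    unfolding ballot_def using 1 2 by (simp_all add: add.commute)
  \<comment> \<open>The recurrence with the common factor \<open>c\<close> and the denominator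
    \<open>(N + 1) * (N + 2)\<close> removed.\<close>
  have "(real k + 2) * (real m + 1) = (real k + 1) * (real N + 2) + (real k + 3) * (real m - real N)"
    unfolding m by (simp add: algebra_simps)
  moreover have "(real k + 1) / (real N + 1) * c = (real k + 1) * (real N + 2) * c / ((real N + 2) * (real N + 1))"
    by simp
  ultimately have "ballot (Suc N) (Suc k) = (real k + 1) / (real N + 1) * c + ballot (Suc N) (Suc (Suc k))"
    unfolding b by (simp only: times_divide_times_eq times_divide_eq_right times_divide_eq_left
        mult.assoc[symmetric] add_divide_distrib[symmetric] distrib_right[symmetric] divide_divide_eq_left)
  then show ?thesis by (simp add: ballot_def c_def m_def)
qed

lemma ballot_diag: "ballot N N = 1"
  by (simp add: ballot_def)

text \<open>Summed form of \<open>ballot_rec\<close>, by downward induction from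
  \<open>k = N\<close>, where both sides are 1.\<close>

lemma ballot_sum:
  assumes "k \<le> N"
  shows "(\<Sum>i=k..N. ballot N i) = ballot (Suc N) (Suc k)"
  using assms
proof (induction k rule: inc_induct)
  case base
  then show ?case by (simp add: ballot_diag)
next
  case (step k)
  then show ?case by (simp add: sum.atLeast_Suc_atMost ballot_rec)
qed

text \<open>Amounts to halving the central binomial coefficient. It covers \<open>k = 0\<close>,
  which the sum recurrence does not reach.\<close>

lemma ballot_0: "ballot (Suc N) 0 = ballot (Suc N) 1"
proof -
  have "Suc (2 * N + 1) * (Suc (2 * N) choose N) = (Suc (2 * N + 1) choose Suc N) * Suc N"
    using Suc_times_binomial_eq[of "2 * N + 1" N] by simp
  moreover have "Suc (2 * N) choose N = Suc (2 * N) choose Suc N"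
    using binomial_symmetric[of N "Suc (2 * N)"] by simp
  ultimately have "(Suc N) * (2 * (Suc (2 * N) choose Suc N)) = Suc N * ((2 * Suc N) choose Suc N)"
    by (simp add: algebra_simps)
  then have "(2 * Suc N) choose Suc N = 2 * ((2 * Suc N - 1) choose Suc N)"
    using mult_left_cancel[of "Suc N"] by (metis add_Suc_right diff_Suc_1 mult_2 add_Suc nat.distinct(1))
  then show ?thesis by (simp add: ballot_def)
qed

lemma card_increasing:
  assumes "k \<le> N"
  shows "real (card {\<pi> \<in> Av321 N. increasing_upto k \<pi>}) = ballot N k"
  using assms
proof (induction N arbitrary: k)
  case 0
  then show ?case
    by (auto simp: Av321_0 ballot_def increasing_upto_def)
next
  case (Suc N)
  have *: "real (card {\<pi> \<in> Av321 (Suc N). increasing_upto (Suc k) \<pi>}) = ballot (Suc N) (Suc k)"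
    if "k \<le> N" for k
    using that by (simp add: card_increasing_Suc Suc.IH ballot_sum[symmetric])
  show ?case
  proof (cases k)
    case 0
    \<comment> \<open>A single entry is always increasing, so \<open>k = 0\<close> and
      \<open>k = 1\<close> give the same count.\<close>
    have "increasing_upto 0 \<pi> \<longleftrightarrow> increasing_upto (Suc 0) \<pi>" for \<pi>
      by (simp add: increasing_upto_def)
    then show ?thesis using 0 *[of 0] by (simp add: ballot_0)
  qed (use Suc.prems * in auto)
qed

section \<open>The numerator: winning permutations with an increasing prefix\<close>

lemma next_max_at_length:
  assumes "next_max_at k v \<sigma>"
  shows "k < length \<sigma>"
proof -
  from assms obtain j where "k \<le> j" "lr_max \<sigma> j" by (auto simp: next_max_at_def)
  then show ?thesis by (simp add: lr_max_def)
qed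

text \<open>An entry followed by another one of the increasing run is not the maximum. This rules
  out most positions of 1 in the recurrences below.\<close>

lemma increasing_nth_less:
  assumes \<sigma>: "\<sigma> \<in> Av321 N" "increasing_upto i \<sigma>" and "Suc j < i" "i \<le> N"
  shows "\<sigma> ! j < N"
proof -
  have "\<sigma> ! j < \<sigma> ! Suc j"
    using assms Av321_D(1)[OF \<sigma>(1)] by (simp add: increasing_upto_def)
  moreover have "\<sigma> ! Suc j \<in> set \<sigma>"
    using assms Av321_D(1)[OF \<sigma>(1)] by simp
  ultimately show ?thesis
    using Av321_D(3)[OF \<sigma>(1)] by simp
qed

text \<open>Pascal's rule: 1 stands either in front, which gives \<open>k - 1\<close>, or directly
  behind the maximum, which gives \<open>k\<close>. The bound \<open>k \<le> N\<close> makes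
  \<open>\<pi> ! k\<close> an actual entry.\<close>

lemma card_max_at:
  "card {\<pi> \<in> Av321 (Suc N). increasing_upto (Suc k) \<pi> \<and> k \<le> N \<and> \<pi> ! k = Suc N} = N choose k"
proof (induction N arbitrary: k)
  case 0
  have "{\<sigma> \<in> Av321 0. P \<sigma>} = (if P [] then {[]} else {})" for P
    by (auto simp: Av321_0)
  then show ?case
    by (cases k) (simp_all add: card_Av321_Suc Av321_0 insert_one_def increasing_upto_def)
next
  case (Suc N)
  define X where "X n k = {\<pi> \<in> Av321 (Suc n). increasing_upto (Suc k) \<pi> \<and> k \<le> n \<and> \<pi> ! k = Suc n}" for n k
  define Y where "Y i = {\<sigma> \<in> Av321 (Suc N). increasing_upto i \<sigma> \<and> increasing_upto (Suc k) (insert_one i \<sigma>)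
     \<and> k \<le> Suc N \<and> insert_one i \<sigma> ! k = Suc (Suc N)}" for i
  \<comment> \<open>For \<open>k = 0\<close> the front entry would be 1 and not the maximum.\<close>
  have Y0: "Y 0 = (if k = 0 then {} else X N (k - 1))"
    unfolding Y_def X_def
    by (cases k) (auto simp: increasing_upto_insert_one Av321_D nth_insert_one increasing_upto_def[of 0])
  have Y1: "Y (Suc k) = X N k" if "k \<le> N"
    unfolding Y_def X_def using that
    by (auto simp: increasing_upto_insert_one Av321_D nth_insert_one)
  have Y2: "Y i = {}" if "i \<le> Suc N" "i \<noteq> 0" "i \<noteq> Suc k" for i
    using that increasing_nth_less[of _ "Suc N" i k]
    by (auto simp: Y_def increasing_upto_insert_one Av321_D nth_insert_one) (metis less_irrefl)
  have "card (X (Suc N) k) = (\<Sum>i\<le>Suc N. card (Y i))"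
    unfolding X_def Y_def by (rule card_Av321_Suc)
  also have "\<dots> = (\<Sum>i\<in>{..Suc N} \<inter> {0, Suc k}. card (Y i))"
    by (rule sum.mono_neutral_right) (auto simp: Y2)
  also have "\<dots> = card (Y 0) + (if k \<le> N then card (Y (Suc k)) else 0)"
    by auto
  also have "\<dots> = card (Y 0) + (N choose k)"
    using Suc.IH[of k, folded X_def] Y1 by (simp add: binomial_eq_0)
  also have "\<dots> = Suc N choose k"
    using Suc.IH unfolding X_def[symmetric] Y0 by (cases k) auto
  finally show ?case by (simp add: X_def)
qed

text \<open>The three summands belong to 1 at index \<open>0\<close>, at \<open>Suc k\<close> and at
  \<open>Suc (Suc k)\<close>; no other index is possible.\<close>

lemma card_won_rec:
  assumes "N \<ge> 1" "Suc k \<le> N"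
  shows "card {\<pi> \<in> Av321 (Suc N). increasing_upto (Suc k) \<pi> \<and> next_max_at (Suc k) (Suc N) \<pi>} =
    card {\<sigma> \<in> Av321 N. increasing_upto k \<sigma> \<and> next_max_at k N \<sigma>} +
    card {\<sigma> \<in> Av321 N. increasing_upto (Suc k) \<sigma> \<and> next_max_at (Suc k) N \<sigma>} +
    ((N - 1) choose Suc k)"
proof -
  obtain M where M: "N = Suc M" using assms(1) by (cases N) auto
  define Y where "Y i = {\<sigma> \<in> Av321 N. increasing_upto i \<sigma> \<and> increasing_upto (Suc k) (insert_one i \<sigma>)
     \<and> next_max_at (Suc k) (Suc N) (insert_one i \<sigma>)}" for i
  \<comment> \<open>With 1 further right, the entry at \<open>Suc k\<close> continues the run. It is
    thus the first left-to-right maximum met and decides the outcome.\<close>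
  have big: "next_max_at (Suc k) (Suc N) (insert_one i \<sigma>) \<longleftrightarrow> \<sigma> ! Suc k = N"
    if "\<sigma> \<in> Av321 N" "increasing_upto i \<sigma>" "Suc k < i" "i \<le> N" for \<sigma> i
  proof -
    have "lr_max (insert_one i \<sigma>) (Suc k)"
      using that Av321_D(1)[OF that(1)]
      by (auto simp: lr_max_def nth_insert_one increasing_upto_def)
    then show ?thesis
      using that Av321_D(1)[OF that(1)] by (simp add: next_max_at_lr_max nth_insert_one)
  qed
  have Y0: "Y 0 = {\<sigma> \<in> Av321 N. increasing_upto k \<sigma> \<and> next_max_at k N \<sigma>}"
    by (auto simp: Y_def increasing_upto_insert_one Av321_D next_max_at_insert_one increasing_upto_def[of 0])
  have Y1: "Y (Suc k) = {\<sigma> \<in> Av321 N. increasing_upto (Suc k) \<sigma> \<and> next_max_at (Suc k) N \<sigma>}"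
    using assms
    by (auto simp: Y_def increasing_upto_insert_one Av321_D next_max_at_insert_one_same)
  have Y2: "Y (Suc (Suc k)) = {\<sigma> \<in> Av321 N. increasing_upto (Suc (Suc k)) \<sigma> \<and> Suc k \<le> N - 1 \<and> \<sigma> ! Suc k = N}"
    if "Suc (Suc k) \<le> N"
    unfolding Y_def
  proof (rule Collect_cong, rule conj_cong, rule refl, rule conj_cong, rule refl)
    fix \<sigma> assume \<sigma>: "\<sigma> \<in> Av321 N" "increasing_upto (Suc (Suc k)) \<sigma>"
    show "increasing_upto (Suc k) (insert_one (Suc (Suc k)) \<sigma>) \<and>
        next_max_at (Suc k) (Suc N) (insert_one (Suc (Suc k)) \<sigma>) \<longleftrightarrow> Suc k \<le> N - 1 \<and> \<sigma> ! Suc k = N"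
      using big[OF \<sigma> _ that] \<sigma> that by (auto simp add: increasing_upto_insert_one Av321_D)
  qed
  have Y3: "Y i = {}" if "i \<le> N" "i \<notin> {0, Suc k, Suc (Suc k)}" for i
  proof -
    have False if "\<sigma> \<in> Y i" for \<sigma>
    proof -
      have \<sigma>: "\<sigma> \<in> Av321 N" "increasing_upto i \<sigma>" using that by (auto simp: Y_def)
      have i: "Suc (Suc k) < i"
        using that \<open>i \<le> N\<close> \<open>i \<notin> _\<close> by (auto simp: Y_def increasing_upto_insert_one Av321_D)
      then have "\<sigma> ! Suc k = N"
        using that big[OF \<sigma>] \<open>i \<le> N\<close> by (simp add: Y_def)
      with increasing_nth_less[OF \<sigma> i \<open>i \<le> N\<close>] show False by simp
    qed
    then show ?thesis by blast
  qed
  have "card {\<pi> \<in> Av321 (Suc N). increasing_upto (Suc k) \<pi> \<and> next_max_at (Suc k) (Suc N) \<pi>}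
      = (\<Sum>i\<le>N. card (Y i))"
    unfolding Y_def by (rule card_Av321_Suc)
  also have "\<dots> = (\<Sum>i\<in>{..N} \<inter> {0, Suc k, Suc (Suc k)}. card (Y i))"
    by (rule sum.mono_neutral_right) (auto simp: Y3)
  also have "\<dots> = card (Y 0) + card (Y (Suc k)) + (if Suc (Suc k) \<le> N then card (Y (Suc (Suc k))) else 0)"
    using assms by (auto simp: Int_insert_right)
  \<comment> \<open>If this index is out of range, the binomial coefficient vanishes too.\<close>
  also have "(if Suc (Suc k) \<le> N then card (Y (Suc (Suc k))) else 0) = (N - 1) choose Suc k"
    using Y2 card_max_at[of M "Suc k"] M by (auto simp: binomial_eq_0)
  finally show ?thesis by (simp add: Y0 Y1)
qed

text \<open>Index 0 always holds a left-to-right maximum, so winning means starting with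
  \<open>N\<close>; \<open>card_max_at\<close> counts one such permutation.\<close>

lemma card_won_0:
  assumes "N \<ge> 1"
  shows "card {\<pi> \<in> Av321 N. increasing_upto 0 \<pi> \<and> next_max_at 0 N \<pi>} = 1"
proof -
  obtain M where M: "N = Suc M" using assms by (cases N) auto
  have "next_max_at 0 N \<pi> \<longleftrightarrow> \<pi> ! 0 = Suc M" if "\<pi> \<in> Av321 N" for \<pi>
  proof -
    have "lr_max \<pi> 0" using Av321_D(1)[OF that] M by (simp add: lr_max_def)
    then show ?thesis using M by (simp add: next_max_at_lr_max)
  qed
  then have "{\<pi> \<in> Av321 N. increasing_upto 0 \<pi> \<and> next_max_at 0 N \<pi>} =
     {\<pi> \<in> Av321 (Suc M). increasing_upto (Suc 0) \<pi> \<and> 0 \<le> M \<and> \<pi> ! 0 = Suc M}"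
    using M by (auto simp: increasing_upto_def)
  then show ?thesis using card_max_at[of M 0] by simp
qed

text \<open>The closed form satisfies \<open>card_won_rec\<close> by Pascal's rule. If
  \<open>k\<close> exceeds \<open>N\<close>, nothing follows the prefix and both sides are
  0.\<close>

lemma card_won:
  "card {\<pi> \<in> Av321 (Suc N). increasing_upto k \<pi> \<and> next_max_at k (Suc N) \<pi>} =
     k * (N choose (k + 1)) + (N choose k)"
proof (induction N arbitrary: k)
  case 0
  show ?case
  proof (cases k)
    case 0
    then show ?thesis using card_won_0[of 1] by simp
  next
    case (Suc l)
    have "{\<pi> \<in> Av321 (Suc 0). increasing_upto k \<pi> \<and> next_max_at k (Suc 0) \<pi>} = {}"
      using next_max_at_length Av321_D(1) Suc by fastforce
    then show ?thesis using Suc by (simp del: Collect_empty_eq)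
  qed
next
  case (Suc N)
  show ?case
  proof (cases k)
    case 0
    then show ?thesis using card_won_0[of "Suc (Suc N)"] by simp
  next
    case k: (Suc l)
    show ?thesis
    proof (cases "k \<le> Suc N")
      case True
      then show ?thesis
        using card_won_rec[of "Suc N" l] k Suc.IH[of l] Suc.IH[of "Suc l"]
        by (simp add: algebra_simps)
    next
      case False
      then have "{\<pi> \<in> Av321 (Suc (Suc N)). increasing_upto k \<pi> \<and> next_max_at k (Suc (Suc N)) \<pi>} = {}"
        using next_max_at_length Av321_D(1) by fastforce
      then show ?thesis using False by (simp add: binomial_eq_0 del: Collect_empty_eq)
    qed
  qed
qed

theorem theorem4p13:
  fixes N :: nat
  assumes "N \<ge> 2"
  shows "(\<forall>k p. k \<le> N - 1 \<and> p \<in> Av321_prefixes N k \<and> has_inversion p \<longrightarrow>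
            trigger_prob N p = trigger_prob (N - 1) (remove_one p))
       \<and> (\<forall>k. k \<le> N - 1 \<longrightarrow>
            fst (trigger_prob N [1..<k+1]) = k * ((N - 1) choose (k + 1)) + ((N - 1) choose k)
          \<and> real (snd (trigger_prob N [1..<k+1]))
              = (real k + 1) / (real N + 1) * real ((2 * N - k) choose N))"
proof -
  obtain M where M: "N = Suc M" using assms by (cases N) auto
  \<comment> \<open>This turns both components of \<open>trigger_prob\<close> into the counts of
    \<open>card_won\<close> and \<open>card_increasing\<close>.\<close>
  have prefix: "restrict_perm \<pi> k = [1..<k+1] \<longleftrightarrow> increasing_upto k \<pi>"
    if "\<pi> \<in> Av321 N" "k \<le> M" for \<pi> k
    using restrict_perm_eq_upt_iff[of k \<pi>] Av321_D(1)[OF that(1)] that(2) M by simp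
  have prob: "trigger_prob N [1..<k+1] =
     (card {\<pi> \<in> Av321 N. increasing_upto k \<pi> \<and> next_max_at k N \<pi>},
      card {\<pi> \<in> Av321 N. increasing_upto k \<pi>})" if "k \<le> M" for k
  proof -
    have "length [1..<k+1] = k" by simp
    then show ?thesis
      unfolding trigger_prob_def won_by_triggering_iff using prefix[OF _ that]
      by (simp cong: conj_cong del: upt_Suc)
  qed
  show ?thesis
    using M prob card_won card_increasing[of _ N] trigger_prob_inversion
    by (auto simp: ballot_def simp del: upt_Suc)
qed

end
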